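(* Let $\mathbb{F}$ be any field, let $V=\mathbb{F}^2\otimes\mathbb{F}^2\otimes\mathbb{F}^2$ (so that $\mathrm{PG}(V)=\mathrm{PG}(7,\mathbb{F})$), let $X\subset \mathrm{PG}(V)$ be the set of $\mathbb{F}$-rational points of the Segre variety $S_{2,2,2}(\mathbb{F})$, and let $G_X$ be the setwise stabiliser of $X$ in $\mathrm{PGL}(V)$. Then the group $G_X$ has exactly four orbits on the singular points of $\mathrm{PG}(V)$.
   Context: Tensor products are over $\mathbb{F}$. For a vector space $V$, $\mathrm{PG}(V)$ denotes the projective space whose points are the one-dimensional subspaces $\langle v\rangle$ of $V$ ($v\neq 0$), and $\mathrm{PGL}(V)$ denotes the projective general linear group acting on it. The set $X$ of $\mathbb{F}$-rational points of the Segre variety $S_{2,2,2}(\mathbb{F})$ (product of three projective lines) is the image of the Segre embedding $\mathrm{PG}(V_1)\times\mathrm{PG}(V_2)\times\mathrm{PG}(V_3)\to \mathrm{PG}(V)$, $(\langle v_1\rangle,\langle v_2\rangle,\langle v_3\rangle)\mapsto\langle v_1\otimes v_2\otimes v_3\rangle$, where $V_1=V_2=V_3=\mathbb{F}^2$ and $V=V_1\otimes V_2\otimes V_3$. Contractions: let $V_i$ ($i\in I$, $I$ finite) be finite dimensional vector spaces over $\mathbb{F}$ with duals $V_i^\vee$. For $w_i^\vee\in V_i^\vee$, the contraction $v\mapsto w_i^\vee(v)$ is the linear map $\bigotimes_{j\in I}V_j\to\bigotimes_{j\in I\setminus\{i\}}V_j$ determined on pure tensors by sending $\bigotimes_{j\in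 I} v_j$ to $w_i^\vee(v_i)\bigotimes_{j\in I\setminus\{i\}}v_j$. Nonsingularity, defined by induction on $|I|$: if $|I|=1$, a vector $u\in V_i$ is nonsingular if $u\neq 0$; if $|I|\ge 2$, a tensor $v\in\bigotimes_{i\in I}V_i$ is nonsingular if for every $i\in I$ and every nonzero $w_i^\vee\in V_i^\vee$ the contraction $w_i^\vee(v)$ is nonsingular. A tensor is singular if it is not nonsingular. A point $\langle v\rangle$ of $\mathrm{PG}(V)$ is called singular if $v$ is singular, and nonsingular otherwise. *)

theory Defs
  imports "HOL-Analysis.Analysis" "HOL-Algebra.Group_Action"
begin

section \<open>Tensors\<close>

text \<open>
  The tensor product of copies \<open>V\<^sub>i = 'a^'d\<close> of one coordinate space, indexed by a finite type
  \<open>'i\<close>, is the space of arrays with index set \<open>'i \<Rightarrow> 'd\<close>. For \<open>I \<subseteq> UNIV\<close>, the tensor product over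
  \<open>i \<in> I\<close> is represented inside this type, as the arrays \<open>v\<close> for which \<open>v $ f\<close> depends only on
  the values of \<open>f\<close> on \<open>I\<close>.
\<close>

type_synonym ('a, 'i, 'd) tensor = "('a, 'i \<Rightarrow> 'd) vec"

definition pure_tensor ::
    "'i set \<Rightarrow> ('i \<Rightarrow> 'a::field ^ 'd) \<Rightarrow> ('a, 'i::finite, 'd::finite) tensor" where
  "pure_tensor I u = (\<chi> f. \<Prod>i\<in>I. u i $ f i)"

lemma pure_tensor_axis:
  "pure_tensor UNIV (\<lambda>i. axis (f i) 1) = (axis f 1 :: ('a::field, 'i::finite, 'd::finite) tensor)"
proof -
  have "(\<Prod>i\<in>UNIV. axis (f i) (1::'a) $ g i) = axis f 1 $ g" for g :: "'i \<Rightarrow> 'd"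
  proof (cases "g = f")
    case False
    then obtain i where "g i \<noteq> f i" by auto
    then have "\<exists>i\<in>UNIV. axis (f i) (1::'a) $ g i = 0"
      by (auto simp: axis_def)
    then have "(\<Prod>i\<in>UNIV. axis (f i) (1::'a) $ g i) = 0"
      by (intro prod_zero) auto
    with False show ?thesis by (simp add: axis_def)
  qed (simp add: axis_def)
  then show ?thesis by (simp add: pure_tensor_def vec_eq_iff)
qed

text \<open>
  Contraction with a functional \<open>w\<close> on the factor \<open>V\<^sub>i\<close>: apply \<open>w\<close> to every fibre of the array in
  direction \<open>i\<close>. The two lemmas below show that, for linear \<open>w\<close>, this is the linear map with the
  required values on pure tensors.
\<close>

definition contraction ::
    "'i \<Rightarrow> ('a::field ^ 'd \<Rightarrow> 'a) \<Rightarrow> ('a, 'i::finite, 'd::finite) tensor \<Rightarrow> ('a, 'i, 'd) tensor" where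
  "contraction i w v = (\<chi> f. w (\<chi> k. v $ f(i := k)))"

lemma linear_contraction:
  assumes "Vector_Spaces.linear (*s) (*) w"
  shows "Vector_Spaces.linear (*s) (*s) (contraction i w)"
proof -
  interpret w: Vector_Spaces.linear "(*s)" "(*)" w by fact
  have 1: "(\<chi> k. x $ f(i := k) + y $ f(i := k)) =
      (\<chi> k. x $ f(i := k)) + (\<chi> k. y $ f(i := k))" for x y f
    by (simp add: vec_eq_iff)
  have 2: "(\<chi> k. c * x $ f(i := k)) = c *s (\<chi> k. x $ f(i := k))" for c x f
    by (simp add: vec_eq_iff)
  show ?thesis
    by unfold_locales
      (simp_all add: contraction_def vec_eq_iff 1 2 w.add w.scale algebra_simps)
qed

lemma contraction_pure_tensor:
  assumes "Vector_Spaces.linear (*s) (*) w" and "i \<in> I"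
  shows "contraction i w (pure_tensor I u) = w (u i) *s pure_tensor (I - {i}) u"
proof -
  interpret w: Vector_Spaces.linear "(*s)" "(*)" w by fact
  have "(\<Prod>j\<in>I. u j $ (f(i := k)) j) = (\<Prod>j\<in>I - {i}. u j $ f j) * u i $ k" for f k
    using \<open>i \<in> I\<close> by (simp add: prod.remove[of I i] mult.commute)
  then have "(\<chi> k. pure_tensor I u $ f(i := k)) = (\<Prod>j\<in>I - {i}. u j $ f j) *s u i" for f
    unfolding pure_tensor_def by (simp only: vec_eq_iff vec_lambda_beta vector_smult_component) simp
  then have "contraction i w (pure_tensor I u) $ f = (\<Prod>j\<in>I - {i}. u j $ f j) * w (u i)" for f
    by (simp only: contraction_def vec_lambda_beta w.scale)
  then show ?thesis
    by (simp add: vec_eq_iff pure_tensor_def mult.commute)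
qed

inductive nonsingular_tensor ::
    "'i set \<Rightarrow> ('a::field, 'i::finite, 'd::finite) tensor \<Rightarrow> bool" where
  single: "v \<noteq> 0 \<Longrightarrow> nonsingular_tensor {i} v"
| step: "\<lbrakk>card I \<ge> 2;
    \<forall>i\<in>I. \<forall>w. Vector_Spaces.linear (*s) (*) w \<and> w \<noteq> (\<lambda>_. 0) \<longrightarrow>
      nonsingular_tensor (I - {i}) (contraction i w v)\<rbrakk>
    \<Longrightarrow> nonsingular_tensor I v"


section \<open>Projective spaces\<close>

definition PG :: "('a::field ^ 'n::finite) set set" where
  "PG = {vec.span {v} | v. v \<noteq> 0}"

text \<open>
  The projective general linear group, as the group of permutations of the points induced by
  the invertible linear maps. It is the general linear group modulo scalars, since a linear map
  that fixes every point is a scalar.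
\<close>

definition PGL :: "(('a::field ^ 'n::finite) set \<Rightarrow> ('a ^ 'n) set) monoid" where
  "PGL = BijGroup PG \<lparr>carrier :=
    {restrict (image g) PG | g. Vector_Spaces.linear (*s) (*s) g \<and> bij g}\<rparr>"

definition setwise_stabiliser ::
    "('a::field ^ 'n::finite) set set \<Rightarrow> (('a ^ 'n) set \<Rightarrow> ('a ^ 'n) set) monoid" where
  "setwise_stabiliser X = PGL \<lparr>carrier := {\<pi> \<in> carrier PGL. \<pi> ` X = X}\<rparr>"


section \<open>The product of three projective lines\<close>

type_synonym 'a V222 = "('a, 3, 2) tensor"

definition segre_222 :: "'a::field V222 set set" where
  "segre_222 = {vec.span {pure_tensor UNIV u} | u. \<forall>i. u i \<noteq> 0}"

definition singular_points :: "'a::field V222 set set" where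
  "singular_points = {vec.span {v} | v. v \<noteq> 0 \<and> \<not> nonsingular_tensor UNIV v}"

end

theory Submission
  imports Defs
begin

text \<open>
  Let \<open>D\<close> be the cone of decomposable tensors in \<open>F\<^sup>2 \<otimes> F\<^sup>2 \<otimes> F\<^sup>2\<close>. A projectivity
  stabilises the Segre variety if and only if it is induced by a linear bijection that maps \<open>D\<close> onto
  \<open>D\<close> (\<open>carrier_setwise_stabiliser_segre\<close>). Invariants of the action come from constructions that
  refer to \<open>D\<close> and addition alone, and elements that move tensors to a normal form come from maps
  acting on one factor (\<open>factor_map\<close>) and permutations of the factors (\<open>permute_factors\<close>).

  Unfolding the recursive definition, a tensor is singular if and only if two contractions in
  different places, with nonzero functionals, make it vanish (\<open>singular_iff\<close>). Choosing bases adapted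
  to these functionals and reordering the factors brings it to the form
  \<open>e1 \<otimes> e1 \<otimes> c1 + e1 \<otimes> e2 \<otimes> c2 + e2 \<otimes> e1 \<otimes> c3\<close>. The linear relations among the three vectors
  \<open>c1, c2, c3\<close> in the plane then lead, for nonzero tensors, to one of four representatives over any field
  (\<open>singular_equiv_rep\<close>):
  \<open>e1 \<otimes> e1 \<otimes> e1\<close>, \<open>e1 \<otimes> (e1 \<otimes> e1 + e2 \<otimes> e2)\<close>, \<open>e1 \<otimes> e1 \<otimes> e1 + e2 \<otimes> e2 \<otimes> e2\<close> and
  \<open>e2 \<otimes> e1 \<otimes> e1 + e1 \<otimes> e2 \<otimes> e1 + e1 \<otimes> e1 \<otimes> e2\<close>.

  The representatives are separated by sets that are defined from \<open>D\<close> and addition alone.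
  For \<open>r \<in> D\<close> let \<open>N r\<close> be the set of all \<open>p \<in> D\<close> with \<open>p + r \<in> D\<close>; for \<open>r \<noteq> 0\<close> its members differ from
  \<open>r\<close> in at most one factor (\<open>neighbours_pure_tensor\<close>). Consider
  \<^item> \<open>D\<close> itself;
  \<^item> the sums of two members of the same \<open>N r\<close> with \<open>r \<noteq> 0\<close> (\<open>linked_secants\<close>);
  \<^item> the sums of two members of \<open>D\<close> (\<open>secants\<close>).
  Each set contains the previous one, and each of the first three representatives lies in exactly
  one more of them than the next one; the last representative is in none.

  The same point of view shows that singularity is preserved by the group. The sums of three members
  of the same \<open>N r\<close> with \<open>r \<noteq> 0\<close> are the tangent vectors of the Segre variety, and a tensor is
  singular if and only if it is a sum of two members of \<open>D\<close> or such a tangent vector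
  (\<open>singular_iff_secant_or_tangent\<close>).
\<close>

section \<open>Decomposable tensors and their contractions\<close>

lemma pure_tensor_eq_0_iff: "pure_tensor I u = 0 \<longleftrightarrow> (\<exists>i\<in>I. u i = 0)"
proof
  assume *: "pure_tensor I u = 0"
  show "\<exists>i\<in>I. u i = 0"
  proof (rule ccontr)
    assume "\<not> (\<exists>i\<in>I. u i = 0)"
    then have "\<forall>i\<in>I. \<exists>k. u i $ k \<noteq> 0" by (metis vec_eq_iff zero_index)
    then obtain f where "\<forall>i\<in>I. u i $ f i \<noteq> 0" by metis
    then have "pure_tensor I u $ f \<noteq> 0" by (simp add: pure_tensor_def)
    with * show False by simp
  qed
next
  assume "\<exists>i\<in>I. u i = 0"
  then show "pure_tensor I u = 0" by (auto simp: pure_tensor_def vec_eq_iff)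
qed

lemma pure_tensor_scale:
  "pure_tensor I (\<lambda>i. c i *s u i) = (\<Prod>i\<in>I. c i) *s pure_tensor I u"
  by (simp add: pure_tensor_def vec_eq_iff prod.distrib)

lemma pure_tensor_scale_upd:
  assumes "k \<in> I"
  shows "pure_tensor I (u(k := c *s x)) = c *s pure_tensor I (u(k := x))"
proof -
  have "(\<lambda>i. (if i = k then c else 1) *s (u(k := x)) i) = u(k := c *s x)"
    by auto
  moreover have "(\<Prod>i\<in>I. if i = k then c else 1) = c"
    using assms by simp
  ultimately show ?thesis using pure_tensor_scale[of I "\<lambda>i. if i = k then c else 1" "u(k := x)"] by simp
qed

definition decomposable :: "('a::field, 'i::finite, 'd::finite) tensor set" where
  "decomposable = range (pure_tensor UNIV)"

lemma zero_decomposable: "0 \<in> decomposable"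
proof -
  have "pure_tensor UNIV (\<lambda>_. 0) = 0" by (simp add: pure_tensor_eq_0_iff)
  then show ?thesis unfolding decomposable_def by (metis rangeI)
qed

lemma scale_decomposable: "p \<in> decomposable \<Longrightarrow> c *s p \<in> decomposable"
  unfolding decomposable_def
proof (elim rangeE)
  fix u :: "'b \<Rightarrow> 'a ^ 'c" assume p: "p = pure_tensor UNIV u"
  obtain k :: "'b" where True by blast
  have "c *s p = pure_tensor UNIV (u(k := c *s u k))"
    using pure_tensor_scale_upd[of k UNIV u c "u k"] p by simp
  then show "c *s p \<in> range (pure_tensor UNIV)" by simp
qed

text \<open>
  For \<open>y \<noteq> 0\<close> the functional \<open>wedge y\<close> is nonzero with kernel spanned by \<open>y\<close>, so contracting with
  it kills exactly those pure tensors that have a factor parallel to \<open>y\<close> in the given place (or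
  that vanish anyway).
\<close>

definition wedge :: "'a::field ^ 2 \<Rightarrow> 'a ^ 2 \<Rightarrow> 'a" where
  "wedge y x = y $ 1 * x $ 2 - y $ 2 * x $ 1"

lemma linear_wedge: "Vector_Spaces.linear (*s) (*) (wedge y)"
  by unfold_locales (simp_all add: wedge_def algebra_simps)

lemma wedge_self [simp]: "wedge y y = 0"
  by (simp add: wedge_def)

lemma wedge_commute: "wedge y x = - wedge x y"
  by (simp add: wedge_def)

lemma wedge_0 [simp]: "wedge 0 x = 0" "wedge x 0 = 0"
  by (simp_all add: wedge_def)

lemma wedge_eq_0_imp_multiple:
  assumes "wedge y x = 0" "y \<noteq> 0"
  obtains c where "x = c *s y"
proof (cases "y $ 1 = 0")
  case True
  then have "y $ 2 \<noteq> 0" using assms(2) by (auto simp: vec_eq_iff forall_2)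
  with True assms(1) have "x = (x $ 2 / y $ 2) *s y"
    by (simp add: vec_eq_iff forall_2 wedge_def)
  then show thesis by (rule that)
next
  case False
  with assms(1) have "x = (x $ 1 / y $ 1) *s y"
    by (simp add: vec_eq_iff forall_2 wedge_def field_simps)
  then show thesis by (rule that)
qed

lemma contraction_wedge_pure:
  "i \<in> I \<Longrightarrow> contraction i (wedge y) (pure_tensor I u) = wedge y (u i) *s pure_tensor (I - {i}) u"
  by (rule contraction_pure_tensor[OF linear_wedge])

lemma contraction_wedge_add:
  "contraction i (wedge y) (v + v') = contraction i (wedge y) v + contraction i (wedge y) v'"
  using linear_contraction[OF linear_wedge] by (rule vec.linear_add)

lemma contraction_wedge_scale:
  "contraction i (wedge y) (c *s v) = c *s contraction i (wedge y) v"
  using linear_contraction[OF linear_wedge] by (rule vec.linear_scale)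

section \<open>Lines on the Segre variety\<close>

text \<open>
  Contracting with \<open>wedge (u' i)\<close> removes the second summand and leaves a nonzero multiple of
  \<open>u\<close> without its factor \<open>i\<close>, which must then be a multiple of \<open>x\<close> without its factor \<open>i\<close>. All
  remaining factors of \<open>u\<close> are therefore parallel to those of \<open>x\<close>.
\<close>

lemma parallel_factor:
  fixes u u' x :: "'i::finite \<Rightarrow> 'a::field ^ 2"
  assumes sum: "pure_tensor UNIV u + pure_tensor UNIV u' = pure_tensor UNIV x"
    and nz: "\<And>i. u i \<noteq> 0" and "i \<noteq> j" and i: "wedge (u' i) (u i) \<noteq> 0"
  shows "x j \<noteq> 0 \<and> wedge (x j) (u j) = 0"
proof -
  have "contraction i (wedge (u' i)) (pure_tensor UNIV u + pure_tensor UNIV u')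
      = contraction i (wedge (u' i)) (pure_tensor UNIV x)"
    by (simp add: sum)
  then have eq: "wedge (u' i) (u i) *s pure_tensor (UNIV - {i}) u
      = wedge (u' i) (x i) *s pure_tensor (UNIV - {i}) x"
    by (simp add: contraction_wedge_add contraction_wedge_pure)
  have "wedge (u' i) (u i) *s pure_tensor (UNIV - {i}) u \<noteq> 0"
    using i nz by (simp add: pure_tensor_eq_0_iff vec.scale_eq_0_iff)
  with eq have "x j \<noteq> 0"
    using \<open>i \<noteq> j\<close> by (auto simp: pure_tensor_eq_0_iff vec.scale_eq_0_iff)
  have "contraction j (wedge (x j)) (wedge (u' i) (u i) *s pure_tensor (UNIV - {i}) u) = 0"
    unfolding eq using \<open>i \<noteq> j\<close>
    by (simp add: contraction_wedge_scale contraction_wedge_pure)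
  then have "wedge (x j) (u j) = 0"
    using \<open>i \<noteq> j\<close> i nz
    by (simp add: contraction_wedge_scale contraction_wedge_pure vec.scale_eq_0_iff pure_tensor_eq_0_iff)
  with \<open>x j \<noteq> 0\<close> show ?thesis by blast
qed

text \<open>
  If the vectors at place \<open>i\<close> are independent, then both \<open>u j\<close> and \<open>u' j\<close> are parallel to the factor
  \<open>x j\<close> of the sum. So the factors can be independent in at most one place.
\<close>

lemma decomposable_sum_parallel:
  fixes u u' :: "'i::finite \<Rightarrow> 'a::field ^ 2"
  assumes sum: "pure_tensor UNIV u + pure_tensor UNIV u' \<in> decomposable"
    and nz: "\<And>i. u i \<noteq> 0" "\<And>i. u' i \<noteq> 0" and "i \<noteq> j"
  shows "wedge (u i) (u' i) = 0 \<or> wedge (u j) (u' j) = 0"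
proof (cases "wedge (u i) (u' i) = 0")
  case False
  note neq' = this
  then have neq: "wedge (u' i) (u i) \<noteq> 0" by (simp add: wedge_commute[of "u' i"])
  obtain x where x: "pure_tensor UNIV u + pure_tensor UNIV u' = pure_tensor UNIV x"
    using sum by (auto simp: decomposable_def)
  then have x': "pure_tensor UNIV u' + pure_tensor UNIV u = pure_tensor UNIV x"
    by (simp add: add.commute)
  have xj: "x j \<noteq> 0" "wedge (x j) (u j) = 0" "wedge (x j) (u' j) = 0"
    using parallel_factor[OF x nz(1) \<open>i \<noteq> j\<close> neq] parallel_factor[OF x' nz(2) \<open>i \<noteq> j\<close> neq'] by auto
  then obtain c d where "u j = c *s x j" "u' j = d *s x j"
    by (metis wedge_eq_0_imp_multiple)
  then show ?thesis by (simp add: wedge_def)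
qed simp

text \<open>
  For a nonzero decomposable tensor \<open>r\<close>, this is the union of the linear spaces obtained by letting
  one factor of \<open>r\<close> vary, that is, of the lines through \<open>\<langle>r\<rangle>\<close> on the Segre variety (for
  two-dimensional factors). Phrased in terms of the set of decomposable tensors alone, the notion is
  visibly invariant under all linear maps that preserve this set.
\<close>

definition neighbours :: "('a::field, 'i::finite, 'd::finite) tensor \<Rightarrow> ('a, 'i, 'd) tensor set" where
  "neighbours r = {p \<in> decomposable. p + r \<in> decomposable}"

lemma neighbours_pure_tensor:
  fixes u :: "'i::finite \<Rightarrow> 'a::field ^ 2"
  assumes "p \<in> neighbours (pure_tensor UNIV u)" and nz: "\<And>i. u i \<noteq> 0"
  obtains k c where "p = pure_tensor UNIV (u(k := c))"
proof -
  obtain u' where p: "p = pure_tensor UNIV u'"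
    and sum: "pure_tensor UNIV u' + pure_tensor UNIV u \<in> decomposable"
    using assms(1) by (auto simp: neighbours_def decomposable_def)
  show thesis
  proof (cases "\<exists>i. u' i = 0")
    case True
    obtain k :: "'i" where True by blast
    have "p = 0" "pure_tensor UNIV (u(k := 0)) = 0"
      using True by (auto simp: p pure_tensor_eq_0_iff)
    then show thesis using that by metis
  next
    case False
    then have "wedge (u i) (u' i) = 0 \<or> wedge (u j) (u' j) = 0" if "i \<noteq> j" for i j
      using decomposable_sum_parallel[of u u' i j] sum nz that by (simp add: add.commute)
    then obtain k where "\<And>i. i \<noteq> k \<Longrightarrow> wedge (u i) (u' i) = 0" by metis
    then have "\<forall>i. \<exists>c. i \<noteq> k \<longrightarrow> u' i = c *s u i"
      using wedge_eq_0_imp_multiple nz by metis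
    then obtain c where c: "\<And>i. i \<noteq> k \<Longrightarrow> u' i = c i *s u i" by metis
    \<comment> \<open>The scalars of the shared factors are collected and moved into the free factor \<open>k\<close>.\<close>
    define d where "d = c(k := 1)"
    have "u' = (\<lambda>i. d i *s (u(k := u' k)) i)"
      using c by (auto simp: d_def)
    then have "p = (\<Prod>i\<in>UNIV. d i) *s pure_tensor UNIV (u(k := u' k))"
      unfolding p using pure_tensor_scale[of UNIV d "u(k := u' k)"] by simp
    also have "\<dots> = pure_tensor UNIV (u(k := (\<Prod>i\<in>UNIV. d i) *s u' k))"
      by (simp add: pure_tensor_scale_upd)
    finally show thesis by (rule that)
  qed
qed

section \<open>Singularity as the vanishing of a double contraction\<close>

lemma nonsingular_singleton: "nonsingular_tensor {i} v \<longleftrightarrow> v \<noteq> 0"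
  by (auto elim: nonsingular_tensor.cases intro: nonsingular_tensor.single)

text \<open>
  A set with at least two elements is not a singleton, so the recursive rule is the only one that
  applies and can be inverted.
\<close>

lemma nonsingular_step:
  "card I \<ge> 2 \<Longrightarrow> nonsingular_tensor I v \<longleftrightarrow>
    (\<forall>i\<in>I. \<forall>w. Vector_Spaces.linear (*s) (*) w \<and> w \<noteq> (\<lambda>_. 0) \<longrightarrow>
      nonsingular_tensor (I - {i}) (contraction i w v))"
  by (auto elim: nonsingular_tensor.cases intro: nonsingular_tensor.step)

lemma third_index:
  fixes i j :: 3
  assumes "i \<noteq> j"
  obtains k where "UNIV - {i} - {j} = {k}" "k \<noteq> i" "k \<noteq> j" "UNIV = {i, j, k}"
proof -
  have "card (UNIV - {i} - {j}) = 1" using assms by (simp add: card_Diff_singleton_if)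
  then obtain k where "UNIV - {i} - {j} = {k}" by (auto simp: card_1_singleton_iff)
  then show thesis by (intro that[of k]) auto
qed

text \<open>
  With three factors the recursion unfolds to two contractions, after which a single vector remains;
  singularity says that some choice of the contractions makes this vector zero.
\<close>

lemma singular_iff:
  fixes v :: "'a::field V222"
  shows "\<not> nonsingular_tensor UNIV v \<longleftrightarrow>
    (\<exists>i j w w'. i \<noteq> j \<and> Vector_Spaces.linear (*s) (*) w \<and> w \<noteq> (\<lambda>_. 0) \<and>
      Vector_Spaces.linear (*s) (*) w' \<and> w' \<noteq> (\<lambda>_. 0) \<and>
      contraction j w' (contraction i w v) = 0)"
proof -
  have 1: "nonsingular_tensor (UNIV - {i} - {j}) x \<longleftrightarrow> x \<noteq> 0"
    if "j \<in> UNIV - {i}" for i j and x :: "'a V222"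
    by (rule third_index[of i j]) (use that in \<open>auto simp: nonsingular_singleton\<close>)
  have 2: "nonsingular_tensor (UNIV - {i}) x \<longleftrightarrow>
    (\<forall>j\<in>UNIV - {i}. \<forall>w. Vector_Spaces.linear (*s) (*) w \<and> w \<noteq> (\<lambda>_. 0) \<longrightarrow>
      contraction j w x \<noteq> 0)" for i and x :: "'a V222"
    by (subst nonsingular_step) (auto simp: 1)
  show ?thesis by (subst nonsingular_step) (auto simp: 2, metis+)
qed

section \<open>Secants and tangents of the Segre variety\<close>

definition secants :: "('a::field, 'i::finite, 'd::finite) tensor set" where
  "secants = {p + q | p q. p \<in> decomposable \<and> q \<in> decomposable}"

text \<open>
  Sums of two decomposable tensors that are both joined to a third one by lines on the Segre
  variety. With three two-dimensional factors, these are the tensors of the form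
  \<open>a \<otimes> M\<close> up to the order of the factors.
\<close>

definition linked_secants :: "('a::field, 'i::finite, 'd::finite) tensor set" where
  "linked_secants = {p + q | r p q. r \<in> decomposable \<and> r \<noteq> 0 \<and> p \<in> neighbours r \<and> q \<in> neighbours r}"

text \<open>
  With three factors, the sums of three neighbours of \<open>r\<close> form the affine tangent space to the Segre
  variety at \<open>\<langle>r\<rangle>\<close>, since varying each of the three factors to first order gives one
  summand.
\<close>

definition tangents :: "('a::field, 'i::finite, 'd::finite) tensor set" where
  "tangents = {p + q + s | r p q s. r \<in> decomposable \<and> r \<noteq> 0 \<and>
    p \<in> neighbours r \<and> q \<in> neighbours r \<and> s \<in> neighbours r}"

lemma secantsI: "p \<in> decomposable \<Longrightarrow> q \<in> decomposable \<Longrightarrow> p + q \<in> secants"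
  by (auto simp: secants_def)

lemma linked_secantsI:
  "r \<in> decomposable \<Longrightarrow> r \<noteq> 0 \<Longrightarrow> p \<in> neighbours r \<Longrightarrow> q \<in> neighbours r \<Longrightarrow> p + q \<in> linked_secants"
  by (auto simp: linked_secants_def)

lemma contraction_wedge_0: "contraction i (wedge y) 0 = 0"
  using contraction_wedge_scale[of i y 0 0] by simp

lemma wedge_nonzero:
  assumes "y \<noteq> 0" shows "wedge y \<noteq> (\<lambda>_. 0)"
proof
  assume *: "wedge y = (\<lambda>_. 0)"
  have "wedge y (axis 1 1) = - y $ 2" "wedge y (axis 2 1) = y $ 1"
    by (simp_all add: wedge_def axis_def)
  with * assms show False by (auto simp: vec_eq_iff forall_2)
qed

lemma exists_wedge_eq_0: "\<exists>y. y \<noteq> 0 \<and> wedge y x = 0"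
proof (cases "x = 0")
  case True
  then have "axis 1 1 \<noteq> (0 :: 'a ^ 2)" "wedge (axis 1 1) x = 0" by (simp_all add: axis_eq_0_iff)
  then show ?thesis by blast
qed (use wedge_self in blast)

lemma singularI:
  fixes v :: "'a::field V222"
  assumes "i \<noteq> j" "y \<noteq> 0" "z \<noteq> 0"
    and "contraction j (wedge z) (contraction i (wedge y) v) = 0"
  shows "\<not> nonsingular_tensor UNIV v"
  unfolding singular_iff using assms linear_wedge wedge_nonzero by blast

text \<open>
  One contraction removes the first summand, and a contraction in another place removes the second.
\<close>

lemma secants_singular:
  fixes v :: "'a::field V222"
  assumes "v \<in> secants"
  shows "\<not> nonsingular_tensor UNIV v"
proof -
  obtain u u' where v: "v = pure_tensor UNIV u + pure_tensor UNIV u'"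
    using assms by (auto simp: secants_def decomposable_def)
  obtain y z where "y \<noteq> 0" "wedge y (u 1) = 0" "z \<noteq> 0" "wedge z (u' 2) = 0"
    using exists_wedge_eq_0 by metis
  then show ?thesis
    by (intro singularI[of 1 2 y z])
      (simp_all add: v contraction_wedge_add contraction_wedge_pure contraction_wedge_scale)
qed

text \<open>
  Every neighbour of \<open>u\<close> agrees with \<open>u\<close> in at least one of the first two places, so contracting
  both places with functionals that vanish on the factors of \<open>u\<close> kills all three summands at once.
\<close>

lemma tangents_singular:
  fixes v :: "'a::field V222"
  assumes "v \<in> tangents"
  shows "\<not> nonsingular_tensor UNIV v"
proof -
  obtain u p q s where v: "v = p + q + s" and u: "pure_tensor UNIV u \<noteq> 0"
    and pqs: "p \<in> neighbours (pure_tensor UNIV u)" "q \<in> neighbours (pure_tensor UNIV u)"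
      "s \<in> neighbours (pure_tensor UNIV u)"
    using assms by (auto simp: tangents_def decomposable_def)
  have nz: "u i \<noteq> 0" for i using u by (simp add: pure_tensor_eq_0_iff)
  have "contraction 2 (wedge (u 2)) (contraction 1 (wedge (u 1)) x) = 0"
    if x: "x \<in> neighbours (pure_tensor UNIV u)" for x
  proof -
    obtain k c where "x = pure_tensor UNIV (u(k := c))"
      using neighbours_pure_tensor[OF x nz] by blast
    then show ?thesis
      by (cases "k = 1") (simp_all add: contraction_wedge_pure contraction_wedge_scale contraction_wedge_0)
  qed
  then show ?thesis using pqs nz
    by (intro singularI[of 1 2 "u 1" "u 2"]) (simp_all add: v contraction_wedge_add)
qed

text \<open>
  The two summands differ from the linking tensor \<open>u\<close> in at most one place each. This leaves a third
  place where both have the factor of \<open>u\<close>, and contracting there kills their sum.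
\<close>

lemma linked_secants_contraction_eq_0:
  fixes v :: "'a::field V222"
  assumes "v \<in> linked_secants"
  obtains i y where "y \<noteq> 0" "contraction i (wedge y) v = 0"
proof -
  obtain u p q where v: "v = p + q" and u: "pure_tensor UNIV u \<noteq> 0"
    and pq: "p \<in> neighbours (pure_tensor UNIV u)" "q \<in> neighbours (pure_tensor UNIV u)"
    using assms by (auto simp: linked_secants_def decomposable_def)
  have nz: "u i \<noteq> 0" for i using u by (simp add: pure_tensor_eq_0_iff)
  obtain k c where p: "p = pure_tensor UNIV (u(k := c))"
    using neighbours_pure_tensor[OF pq(1) nz] by blast
  obtain l d where q: "q = pure_tensor UNIV (u(l := d))"
    using neighbours_pure_tensor[OF pq(2) nz] by blast
  obtain i where "i \<noteq> k" "i \<noteq> l"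
  proof -
    have "card {k, l} < card (UNIV :: 3 set)" by (simp add: card_insert_if)
    then have "{k, l} \<noteq> UNIV" by auto
    then show thesis using that by auto
  qed
  then have "contraction i (wedge (u i)) v = 0"
    by (simp add: v p q contraction_wedge_add contraction_wedge_pure)
  with nz show thesis by (rule that)
qed

section \<open>Four representatives and how to tell them apart\<close>

definition tri :: "'a::field ^ 2 \<Rightarrow> 'a ^ 2 \<Rightarrow> 'a ^ 2 \<Rightarrow> 'a V222" where
  "tri a b c = pure_tensor UNIV (\<lambda>i. if i = 1 then a else if i = 2 then b else c)"

lemma pure_tensor_3_nth:
  "pure_tensor UNIV u $ f = u 1 $ f 1 * u 2 $ f 2 * u 3 $ f (3 :: 3)"
  unfolding pure_tensor_def UNIV_3 by (simp add: mult.assoc)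

lemma tri_nth: "tri a b c $ f = a $ f 1 * b $ f 2 * c $ f 3"
  by (simp add: tri_def pure_tensor_3_nth)

lemma tri_decomposable: "tri a b c \<in> decomposable"
  by (simp add: tri_def decomposable_def)

lemma tri_eq_0_iff: "tri a b c = 0 \<longleftrightarrow> a = 0 \<or> b = 0 \<or> c = 0"
  unfolding tri_def pure_tensor_eq_0_iff UNIV_3 by simp

abbreviation e1 :: "'a::field ^ 2" where "e1 \<equiv> axis 1 1"
abbreviation e2 :: "'a::field ^ 2" where "e2 \<equiv> axis 2 1"

definition "segre_rep = tri e1 e1 e1"
definition "biseparable_rep = tri e1 e1 e1 + tri e1 e2 e2"
definition "secant_rep = tri e1 e1 e1 + tri e2 e2 e2"
definition "tangent_rep = tri e2 e1 e1 + tri e1 e2 e1 + tri e1 e1 e2"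


text \<open>
  For three qubits, these are a product state, a state in which one factor splits off,
  the GHZ state and the W state. The last is the tangent direction at \<open>tri e1 e1 e1\<close> that moves all
  three factors.
\<close>

definition reps :: "'a::field V222 set" where
  "reps = {segre_rep, biseparable_rep, secant_rep, tangent_rep}"

lemma biseparable_rep_not_decomposable: "biseparable_rep \<notin> decomposable"
proof
  assume "biseparable_rep \<in> (decomposable :: 'a V222 set)"
  then show False
    unfolding biseparable_rep_def tri_def
    by (auto dest!: decomposable_sum_parallel[where i = 2 and j = 3]
        simp: wedge_def axis_def vec_eq_iff split: if_splits)
qed

text \<open>
  Every linked secant is killed by some nonzero contraction, whereas any contraction of
  \<open>secant_rep\<close> is a diagonal matrix whose entries are those of the functional.
\<close>

lemma secant_rep_not_linked: "secant_rep \<notin> linked_secants"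
proof
  assume "secant_rep \<in> (linked_secants :: 'a V222 set)"
  then obtain i and y :: "'a ^ 2" where "y \<noteq> 0" and *: "contraction i (wedge y) secant_rep = 0"
    by (rule linked_secants_contraction_eq_0)
  have "contraction i (wedge y) secant_rep $ (\<lambda>_. 1) = - y $ 2"
    "contraction i (wedge y) secant_rep $ (\<lambda>_. 2) = y $ 1"
    using exhaust_3[of i]
    by (auto simp: contraction_def wedge_def secant_rep_def tri_nth axis_def)
  with * \<open>y \<noteq> 0\<close> show False by (auto simp: vec_eq_iff forall_2)
qed

text \<open>
  The quadrics that cut out the Segre variety, in a form where \<open>h\<close> and \<open>h'\<close> arise by exchanging
  some of the coordinates of \<open>f\<close> and \<open>g\<close>.
\<close>

lemma pure_tensor_minor:
  assumes "\<And>i. i \<in> I \<Longrightarrow> {f i, g i} = {h i, h' i}"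
  shows "pure_tensor I u $ f * pure_tensor I u $ g = pure_tensor I u $ h * pure_tensor I u $ h'"
proof -
  have "u i $ f i * u i $ g i = u i $ h i * u i $ h' i" if "i \<in> I" for i
    using assms[OF that] by (auto simp: doubleton_eq_iff)
  then show ?thesis by (simp add: pure_tensor_def flip: prod.distrib)
qed

text \<open>
  Contracting \<open>tangent_rep\<close> in any place with \<open>wedge y\<close> gives a \<open>2 \<times> 2\<close> matrix
  with determinant \<open>- (y $ 2)\<^sup>2\<close>, and the right-hand side has rank at most one.
\<close>

lemma tangent_rep_contraction_multiple:
  fixes y :: "'a::field ^ 2"
  assumes "contraction i (wedge y) tangent_rep = c *s pure_tensor (UNIV - {i}) u"
  shows "y $ 2 = 0"
proof -
  obtain j k where jk: "UNIV - {i} - {j} = {k}" "i \<noteq> j" "k \<noteq> i" "k \<noteq> j"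
    by (metis third_index one_neq_zero)
  define f where "f = (\<lambda>_::3. 1::2)"
  let ?p = "contraction i (wedge y) tangent_rep"
  \<comment> \<open>The contracted tensor is constant in direction \<open>i\<close>, so the indices \<open>f\<close> and \<open>\<lambda>_. 2\<close> stand for
    the diagonal entries of the matrix, and changing \<open>f\<close> at \<open>j\<close> or \<open>k\<close> gives the other two.\<close>
  have "?p $ f * ?p $ (\<lambda>_. 2) = ?p $ (f(j := 2)) * ?p $ (f(k := 2))"
  proof -
    have "{f m, 2} = {(f(j := 2)) m, (f(k := 2)) m}" if "m \<in> UNIV - {i}" for m
    proof -
      have "m = j \<or> m = k" using that jk(1) by auto
      then show ?thesis using jk(4) by (auto simp: f_def)
    qed
    then show ?thesis
      unfolding assms
      using pure_tensor_minor[of "UNIV - {i}" f "\<lambda>_. 2" "f(j := 2)" "f(k := 2)" u]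
      by simp
  qed
  moreover have "?p $ (\<lambda>_. 2) = 0" "?p $ (f(j := 2)) = - y $ 2" "?p $ (f(k := 2)) = - y $ 2"
    using exhaust_3[of i] exhaust_3[of j] exhaust_3[of k] jk(2-4)
    by (elim disjE; simp add: f_def contraction_def wedge_def tangent_rep_def tri_nth axis_def)+
  ultimately show ?thesis by simp
qed

lemma tangent_rep_summand:
  fixes u u' :: "3 \<Rightarrow> 'a::field ^ 2"
  assumes "tangent_rep = pure_tensor UNIV u + pure_tensor UNIV u'"
  shows "u' i $ 2 = 0"
  by (rule tangent_rep_contraction_multiple[of i _ "wedge (u' i) (u i)" u])
    (simp add: assms contraction_wedge_add contraction_wedge_pure)

text \<open>
  Suppose that \<open>tangent_rep\<close> is a sum of two pure tensors. Contracting away either summand shows that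
  all factors of that summand are multiples of \<open>e1\<close>. Hence the whole sum is a multiple of
  \<open>tri e1 e1 e1\<close>, which \<open>tangent_rep\<close> is not.
\<close>

lemma tangent_rep_not_secant: "tangent_rep \<notin> secants"
proof
  assume "tangent_rep \<in> (secants :: 'a V222 set)"
  then obtain u u' :: "3 \<Rightarrow> 'a ^ 2"
    where eq: "tangent_rep = pure_tensor UNIV u + pure_tensor UNIV u'"
    by (auto simp: secants_def decomposable_def)
  then have eq': "tangent_rep = pure_tensor UNIV u' + pure_tensor UNIV u"
    by (simp add: add.commute)
  have "u i $ 2 = 0" "u' i $ 2 = 0" for i
    using tangent_rep_summand[OF eq] tangent_rep_summand[OF eq'] by auto
  then have "(pure_tensor UNIV u + pure_tensor UNIV u') $ ((\<lambda>_. 1)(1 := 2)) = 0"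
    by (simp add: pure_tensor_3_nth)
  moreover have "tangent_rep $ ((\<lambda>_. 1)(1 := 2)) = (1 :: 'a)"
    by (simp add: tangent_rep_def tri_nth axis_def)
  ultimately show False by (simp add: eq)
qed

lemma tri_neighbours:
  "tri x b c \<in> neighbours (tri a b c)" "tri a x c \<in> neighbours (tri a b c)"
  "tri a b x \<in> neighbours (tri a b c)"
proof -
  have "tri x b c + tri a b c = tri (x + a) b c" "tri a x c + tri a b c = tri a (x + b) c"
    "tri a b x + tri a b c = tri a b (x + c)"
    by (simp_all add: vec_eq_iff tri_nth algebra_simps)
  then show "tri x b c \<in> neighbours (tri a b c)" "tri a x c \<in> neighbours (tri a b c)"
    "tri a b x \<in> neighbours (tri a b c)"
    by (simp_all add: neighbours_def tri_decomposable)
qed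

lemma biseparable_rep_linked: "biseparable_rep \<in> linked_secants"
proof -
  have "tri e1 e1 e2 \<noteq> (0 :: 'a V222)" by (simp add: tri_eq_0_iff axis_eq_0_iff)
  moreover have "tri e1 e1 e1 \<in> neighbours (tri e1 e1 e2 :: 'a V222)"
    "tri e1 e2 e2 \<in> neighbours (tri e1 e1 e2 :: 'a V222)"
    by (rule tri_neighbours)+
  ultimately show ?thesis
    unfolding linked_secants_def biseparable_rep_def using tri_decomposable by blast
qed

lemma tangent_rep_tangent: "tangent_rep \<in> tangents"
proof -
  have "tri e1 e1 e1 \<noteq> (0 :: 'a V222)" by (simp add: tri_eq_0_iff axis_eq_0_iff)
  then show ?thesis
    unfolding tangents_def tangent_rep_def using tri_decomposable tri_neighbours by blast
qed

lemma linked_secants_subset_secants: "linked_secants \<subseteq> secants"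
  by (auto simp: linked_secants_def secants_def neighbours_def)

lemma decomposable_subset_linked_secants: "decomposable \<subseteq> (linked_secants :: 'a::field V222 set)"
proof
  fix p :: "'a V222" assume p: "p \<in> decomposable"
  have zero: "0 \<in> neighbours r" if "r \<in> decomposable" for r :: "'a V222"
    using that by (simp add: neighbours_def zero_decomposable)
  show "p \<in> linked_secants"
  proof (cases "p = 0")
    case True
    have "tri e1 e1 e1 \<noteq> (0 :: 'a V222)" by (simp add: tri_eq_0_iff axis_eq_0_iff)
    then have "0 + 0 \<in> (linked_secants :: 'a V222 set)"
      by (intro linked_secantsI[of "tri e1 e1 e1"] zero tri_decomposable)
    with True show ?thesis by simp
  next
    case False
    have "p + p = 2 *s p" by (simp add: vec_eq_iff)
    then have "p \<in> neighbours p" using p by (simp add: neighbours_def scale_decomposable)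
    with False p zero[OF p] show ?thesis using linked_secantsI[of p p 0] by simp
  qed
qed

text \<open>
  The position of a tensor in the chain of its invariant sets: each of the sets used here
  contains the ones before it, and the value 4 stands for the complement of the last one.
\<close>

definition stratum :: "'a::field V222 \<Rightarrow> nat" where
  "stratum v = (if v \<in> decomposable then 1 else if v \<in> linked_secants then 2
    else if v \<in> secants then 3 else 4)"

lemma stratum_reps:
  "stratum (segre_rep :: 'a::field V222) = 1" "stratum (biseparable_rep :: 'a V222) = 2"
  "stratum (secant_rep :: 'a V222) = 3" "stratum (tangent_rep :: 'a V222) = 4"
proof -
  have "segre_rep \<in> (decomposable :: 'a V222 set)" "secant_rep \<in> (secants :: 'a V222 set)"
    unfolding segre_rep_def secant_rep_def secants_def using tri_decomposable by blast+
  moreover have "biseparable_rep \<notin> (decomposable :: 'a V222 set)"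
    "biseparable_rep \<in> (linked_secants :: 'a V222 set)" "secant_rep \<notin> (linked_secants :: 'a V222 set)"
    "tangent_rep \<notin> (secants :: 'a V222 set)"
    by (rule biseparable_rep_not_decomposable biseparable_rep_linked secant_rep_not_linked
        tangent_rep_not_secant)+
  ultimately show "stratum (segre_rep :: 'a V222) = 1" "stratum (biseparable_rep :: 'a V222) = 2"
    "stratum (secant_rep :: 'a V222) = 3" "stratum (tangent_rep :: 'a V222) = 4"
    using decomposable_subset_linked_secants linked_secants_subset_secants
    by (auto simp: stratum_def)
qed

lemma inj_on_stratum_reps: "inj_on stratum reps"
  by (auto simp: inj_on_def reps_def stratum_reps)

lemma card_reps: "card (reps :: 'a::field V222 set) = 4"
proof -
  have "stratum ` (reps :: 'a V222 set) = {1, 2, 3, 4}" by (auto simp: reps_def stratum_reps)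
  then show ?thesis using card_image[OF inj_on_stratum_reps, where ?'a1 = 'a] by simp
qed

section \<open>Linear maps preserving the decomposable tensors\<close>

definition segre_linear :: "(('a::field, 'i::finite, 'd::finite) tensor \<Rightarrow> ('a, 'i, 'd) tensor) \<Rightarrow> bool" where
  "segre_linear g \<longleftrightarrow> Vector_Spaces.linear (*s) (*s) g \<and> bij g \<and> g ` decomposable = decomposable"

text \<open>
  It suffices to test the map and its inverse on pure tensors; the inverse is needed to see that
  the decomposable tensors are mapped onto, and not merely into, themselves.
\<close>

lemma segre_linearI:
  fixes g h :: "('a::field, 'i::finite, 'd::finite) tensor \<Rightarrow> ('a, 'i, 'd) tensor"
  assumes "Vector_Spaces.linear (*s) (*s) g" "\<And>v. g (h v) = v" "\<And>v. h (g v) = v"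
    and "\<And>u. g (pure_tensor UNIV u) \<in> decomposable" "\<And>u. h (pure_tensor UNIV u) \<in> decomposable"
  shows "segre_linear g"
proof -
  have "bij g" using assms(2,3) by (intro o_bij[of h]) auto
  moreover have "g ` decomposable = decomposable"
  proof (intro equalityI subsetI)
    fix x :: "('a, 'i, 'd) tensor" assume "x \<in> decomposable"
    then have "h x \<in> decomposable" using assms(5) by (auto simp: decomposable_def)
    then show "x \<in> g ` decomposable" using assms(2)[of x] by (metis imageI)
  qed (use assms(4) in \<open>auto simp: decomposable_def\<close>)
  ultimately show ?thesis using assms(1) by (simp add: segre_linear_def)
qed

lemma segre_linear_id: "segre_linear id"
  by (simp add: segre_linear_def vec.linear_id)

lemma segre_linear_comp:
  assumes "segre_linear g" "segre_linear h" shows "segre_linear (g \<circ> h)"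
  using assms Vector_Spaces.linear_compose[of "(*s)" "(*s)" h "(*s)" g]
  unfolding segre_linear_def by (metis bij_comp image_comp)

lemma segre_linear_inv:
  assumes "segre_linear g" shows "segre_linear (inv_into UNIV g)"
proof -
  have g: "Vector_Spaces.linear (*s) (*s) g" "bij g" "g ` decomposable = decomposable"
    using assms by (auto simp: segre_linear_def)
  then obtain h where "Vector_Spaces.linear (*s) (*s) h" "h \<circ> g = id"
    using vec.linear_injective_left_inverse[of g] bij_is_inj by blast
  moreover from this have "h = inv_into UNIV g"
    using \<open>bij g\<close> by (metis bij_is_surj inv_unique_comp surj_iff fun.map_id comp_assoc comp_id id_comp)
  moreover have "inv_into UNIV g ` decomposable = decomposable"
    using g by (metis bij_is_inj image_inv_f_f)
  ultimately show ?thesis using \<open>bij g\<close> by (simp add: segre_linear_def bij_imp_bij_inv)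
qed

lemma segre_linear_scale:
  assumes "c \<noteq> 0" shows "segre_linear (\<lambda>v. c *s v)"
proof (rule segre_linearI[where h = "\<lambda>v. inverse c *s v"])
  show "Vector_Spaces.linear (*s) (*s) (\<lambda>v. c *s v)"
    by unfold_locales (simp_all add: vector_add_ldistrib vec_eq_iff algebra_simps)
  show "c *s pure_tensor UNIV u \<in> decomposable" "inverse c *s pure_tensor UNIV u \<in> decomposable" for u
    by (rule scale_decomposable, simp add: decomposable_def)+
qed (use assms in \<open>simp_all add: vec_eq_iff\<close>)

lemma segre_linear_add: "segre_linear g \<Longrightarrow> g (v + w) = g v + g w"
  by (simp add: segre_linear_def vec.linear_add)

lemma segre_linear_nonzero: "segre_linear g \<Longrightarrow> v \<noteq> 0 \<Longrightarrow> g v \<noteq> 0"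
  by (metis segre_linear_def vec.linear_0 bij_is_inj injD)

lemma segre_linear_decomposable: "segre_linear g \<Longrightarrow> p \<in> decomposable \<Longrightarrow> g p \<in> decomposable"
  by (auto simp: segre_linear_def)

lemma segre_linear_neighbours: "segre_linear g \<Longrightarrow> p \<in> neighbours r \<Longrightarrow> g p \<in> neighbours (g r)"
  by (auto simp: neighbours_def segre_linear_decomposable simp flip: segre_linear_add)

lemma segre_linear_secants:
  assumes "segre_linear g" "v \<in> secants" shows "g v \<in> secants"
  using assms(2) segre_linear_decomposable[OF assms(1)]
  unfolding secants_def by (force simp: segre_linear_add[OF assms(1)])

lemma segre_linear_linked_secants:
  assumes "segre_linear g" "v \<in> linked_secants" shows "g v \<in> linked_secants"
proof -
  obtain r p q where "v = p + q" "r \<in> decomposable" "r \<noteq> 0" "p \<in> neighbours r" "q \<in> neighbours r"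
    using assms(2) by (auto simp: linked_secants_def)
  then have "g v = g p + g q" "g r \<in> decomposable" "g r \<noteq> 0"
    "g p \<in> neighbours (g r)" "g q \<in> neighbours (g r)"
    using assms(1) by (simp_all add: segre_linear_add segre_linear_decomposable
        segre_linear_nonzero segre_linear_neighbours)
  then show ?thesis unfolding linked_secants_def by blast
qed

lemma segre_linear_tangents:
  assumes "segre_linear g" "v \<in> tangents" shows "g v \<in> tangents"
proof -
  obtain r p q s where "v = p + q + s" "r \<in> decomposable" "r \<noteq> 0"
    "p \<in> neighbours r" "q \<in> neighbours r" "s \<in> neighbours r"
    using assms(2) by (auto simp: tangents_def)
  then have "g v = g p + g q + g s" "g r \<in> decomposable" "g r \<noteq> 0"
    "g p \<in> neighbours (g r)" "g q \<in> neighbours (g r)" "g s \<in> neighbours (g r)"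
    using assms(1) by (simp_all add: segre_linear_add segre_linear_decomposable
        segre_linear_nonzero segre_linear_neighbours)
  then show ?thesis unfolding tangents_def by blast
qed

text \<open>
  Each set in the definition of \<open>stratum\<close> is mapped into itself by \<open>g\<close> and by the inverse of \<open>g\<close>.
\<close>

lemma segre_linear_stratum: "segre_linear g \<Longrightarrow> stratum (g v) = stratum v"
proof -
  assume g: "segre_linear g"
  then have inv: "segre_linear (inv_into UNIV g)" "inv_into UNIV g (g v) = v"
    by (auto simp: segre_linear_inv) (simp add: segre_linear_def bij_is_inj)
  show "stratum (g v) = stratum v"
    using segre_linear_decomposable[OF g, of v] segre_linear_decomposable[OF inv(1), of "g v"]
      segre_linear_linked_secants[OF g, of v] segre_linear_linked_secants[OF inv(1), of "g v"]
      segre_linear_secants[OF g, of v] segre_linear_secants[OF inv(1), of "g v"] inv(2)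
    by (auto simp: stratum_def)
qed

text \<open>
  The map \<open>id \<otimes> \<dots> \<otimes> A \<otimes> \<dots> \<otimes> id\<close> with \<open>A\<close> acting on the factor \<open>i\<close>.
\<close>

definition factor_map ::
    "'i \<Rightarrow> 'a::field ^ 'd ^ 'd \<Rightarrow> ('a, 'i::finite, 'd::finite) tensor \<Rightarrow> ('a, 'i, 'd) tensor" where
  "factor_map i A v = (\<chi> f. \<Sum>k\<in>UNIV. A $ f i $ k * v $ f(i := k))"

lemma factor_map_pure_tensor:
  "factor_map i A (pure_tensor UNIV u) = pure_tensor UNIV (u(i := A *v u i))"
proof -
  have "pure_tensor UNIV (u(i := x)) $ f = x $ f i * (\<Prod>j\<in>UNIV - {i}. u j $ f j)" for x f
    by (simp add: pure_tensor_def prod.remove[of UNIV i])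
  moreover have "pure_tensor UNIV u $ f(i := k) = u i $ k * (\<Prod>j\<in>UNIV - {i}. u j $ f j)" for f k
    by (simp add: pure_tensor_def prod.remove[of UNIV i])
  ultimately show ?thesis
    by (simp add: vec_eq_iff factor_map_def matrix_vector_mult_def sum_distrib_right mult.assoc)
qed

lemma factor_map_mult: "factor_map i A (factor_map i B v) = factor_map i (A ** B) v"
  by (simp add: vec_eq_iff factor_map_def matrix_matrix_mult_def sum_distrib_left
      sum_distrib_right mult.assoc) (intro allI sum.swap)

lemma factor_map_mat_1: "factor_map i (mat 1) v = v"
proof -
  have "(\<Sum>k\<in>UNIV. mat 1 $ f i $ k * v $ f(i := k)) = v $ f" for f
  proof -
    have "(\<Sum>k\<in>UNIV. mat 1 $ f i $ k * v $ f(i := k)) = (\<Sum>k\<in>UNIV. if k = f i then v $ f else 0)"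
      by (intro sum.cong) (auto simp: mat_def)
    then show ?thesis by simp
  qed
  then show ?thesis by (simp add: factor_map_def)
qed

lemma segre_linear_factor_map:
  assumes "invertible A" shows "segre_linear (factor_map i A)"
proof -
  obtain B where "A ** B = mat 1" "B ** A = mat 1" using assms by (auto simp: invertible_def)
  moreover have "Vector_Spaces.linear (*s) (*s) (factor_map i A)"
    by unfold_locales
      (simp_all add: factor_map_def vec_eq_iff sum.distrib algebra_simps sum_distrib_left)
  ultimately show ?thesis
    by (intro segre_linearI[where h = "factor_map i B"])
      (simp_all add: factor_map_mult factor_map_mat_1 factor_map_pure_tensor decomposable_def)
qed

text \<open>
  For a bijection \<open>\<tau>\<close>, the factor in place \<open>i\<close> is moved to place \<open>\<tau> i\<close>.
\<close>

definition permute_factors ::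
    "('i \<Rightarrow> 'i) \<Rightarrow> ('a::field, 'i::finite, 'd::finite) tensor \<Rightarrow> ('a, 'i, 'd) tensor" where
  "permute_factors \<tau> v = (\<chi> f. v $ (f \<circ> \<tau>))"

lemma permute_factors_pure_tensor:
  assumes "bij \<tau>"
  shows "permute_factors \<tau> (pure_tensor UNIV (u \<circ> \<tau>)) = pure_tensor UNIV u"
  using prod.reindex_bij_betw[OF assms, of "\<lambda>i. u i $ f i" for f]
  by (simp add: permute_factors_def pure_tensor_def vec_eq_iff)

lemma segre_linear_permute_factors:
  assumes "bij \<tau>" shows "segre_linear (permute_factors \<tau>)"
proof -
  have dec: "permute_factors \<sigma> (pure_tensor UNIV u) \<in> decomposable" if "bij \<sigma>" for \<sigma> u
    using permute_factors_pure_tensor[OF that, of "u \<circ> inv_into UNIV \<sigma>"] that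
    by (simp add: comp_assoc bij_is_inj decomposable_def)
  have "Vector_Spaces.linear (*s) (*s) (permute_factors \<tau>)"
    by unfold_locales (simp_all add: permute_factors_def vec_eq_iff algebra_simps)
  moreover have "\<tau> \<circ> inv_into UNIV \<tau> = id" "inv_into UNIV \<tau> \<circ> \<tau> = id"
    using assms surj_iff inj_iff by (auto simp: bij_def)
  ultimately show ?thesis
    using assms dec bij_imp_bij_inv[OF assms]
    by (intro segre_linearI[where h = "permute_factors (inv_into UNIV \<tau>)"])
      (simp_all add: permute_factors_def vec_eq_iff comp_assoc)
qed

section \<open>Normal forms of singular tensors\<close>

definition segre_equiv :: "'a::field V222 \<Rightarrow> 'a V222 \<Rightarrow> bool" where
  "segre_equiv v w \<longleftrightarrow> (\<exists>g. segre_linear g \<and> g v = w)"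

lemma segre_equiv_sym: "segre_equiv v w \<Longrightarrow> segre_equiv w v"
  unfolding segre_equiv_def using segre_linear_inv
  by (metis bij_is_inj inv_f_f segre_linear_def)

lemma segre_equiv_trans: "segre_equiv v w \<Longrightarrow> segre_equiv w x \<Longrightarrow> segre_equiv v x"
  unfolding segre_equiv_def using segre_linear_comp comp_apply by metis

lemma wedge_basis_to_axes:
  fixes a b :: "'a::field ^ 2"
  assumes "wedge a b \<noteq> 0"
  obtains A :: "'a ^ 2 ^ 2" where "invertible A" "A *v a = e1" "A *v b = e2"
proof
  let ?d = "wedge a b"
  \<comment> \<open>The inverse, by Cramer's rule, of the matrix with columns \<open>a\<close> and \<open>b\<close>.\<close>
  let ?A = "\<chi> i. if i = 1 then vector [b $ 2 / ?d, - b $ 1 / ?d] else vector [- a $ 2 / ?d, a $ 1 / ?d] :: 'a ^ 2 ^ 2"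
  have "det ?A = 1 / ?d" using assms by (simp add: det_2 field_simps) (simp add: wedge_def algebra_simps)
  then show "invertible ?A" using assms by (simp add: invertible_det_nz)
  show "?A *v a = e1" "?A *v b = e2"
    using assms by (simp_all add: vec_eq_iff forall_2 matrix_vector_mult_def sum_2 axis_def field_simps)
      (simp_all add: wedge_def)
qed

lemma wedge_extend:
  assumes "a \<noteq> (0 :: 'a::field ^ 2)" obtains b where "wedge a b \<noteq> 0"
  using wedge_nonzero[OF assms] by auto

lemma wedge_span:
  fixes a b :: "'a::field ^ 2"
  assumes "wedge a b \<noteq> 0"
  obtains s t where "x = s *s a + t *s b"
proof
  show "x = (wedge x b / wedge a b) *s a + (wedge a x / wedge a b) *s b"
    using assms by (simp add: vec_eq_iff forall_2 field_simps) (simp add: wedge_def algebra_simps)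
qed

text \<open>
  Any nonzero functional can be completed to an invertible matrix that has it as second row. This
  turns contractions into coordinates.
\<close>

lemma functional_as_row:
  fixes w :: "'a::field ^ 2 \<Rightarrow> 'a"
  assumes "Vector_Spaces.linear (*s) (*) w" "w \<noteq> (\<lambda>_. 0)"
  obtains A :: "'a ^ 2 ^ 2" where "invertible A" "\<And>x. (\<Sum>k\<in>UNIV. A $ 2 $ k * x $ k) = w x"
proof -
  interpret w: Vector_Spaces.linear "(*s)" "(*)" w by fact
  have w: "w x = w e1 * x $ 1 + w e2 * x $ 2" for x
  proof -
    have "x = x $ 1 *s e1 + x $ 2 *s e2" by (simp add: vec_eq_iff forall_2 axis_def)
    then have "w x = w (x $ 1 *s e1 + x $ 2 *s e2)" by simp
    then show ?thesis by (simp add: w.add w.scale mult.commute)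
  qed
  with assms(2) have nz: "w e1 \<noteq> 0 \<or> w e2 \<noteq> 0" by force
  let ?A = "\<chi> i. if i = 1 then (if w e1 \<noteq> 0 then e2 else e1) else vector [w e1, w e2] :: 'a ^ 2 ^ 2"
  have "det ?A \<noteq> 0" using nz by (auto simp: det_2 axis_def)
  then have "invertible ?A" by (simp add: invertible_det_nz)
  moreover have "(\<Sum>k\<in>UNIV. ?A $ 2 $ k * x $ k) = w x" for x
    by (subst w) (simp add: sum_2)
  ultimately show thesis by (rule that)
qed

lemma factor_map_tri:
  "factor_map 1 A (tri a b c) = tri (A *v a) b c"
  "factor_map 2 A (tri a b c) = tri a (A *v b) c"
  "factor_map 3 A (tri a b c) = tri a b (A *v c)"
  unfolding tri_def factor_map_pure_tensor by (rule arg_cong[of _ _ "pure_tensor UNIV"], simp add: fun_eq_iff forall_3)+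

lemma tri_map:
  assumes "invertible A" "invertible B" "invertible C"
  obtains g where "segre_linear g" "\<And>a b c. g (tri a b c) = tri (A *v a) (B *v b) (C *v c)"
proof
  let ?g = "factor_map 1 A \<circ> (factor_map 2 B \<circ> factor_map 3 C)"
  show "segre_linear ?g" by (intro segre_linear_comp segre_linear_factor_map assms)
  show "?g (tri a b c) = tri (A *v a) (B *v b) (C *v c)" for a b c
    by (simp add: factor_map_tri)
qed

text \<open>
  A choice of bases in the three factors can be moved to the standard bases. The listed pure
  tensors are those that occur in the representatives.
\<close>

lemma tri_basis_map:
  assumes "wedge a a' \<noteq> 0" "wedge b b' \<noteq> 0" "wedge c c' \<noteq> 0"
  obtains g where "segre_linear g"
    "g (tri a b c) = tri e1 e1 e1" "g (tri a' b c) = tri e2 e1 e1" "g (tri a b' c) = tri e1 e2 e1"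
    "g (tri a b c') = tri e1 e1 e2" "g (tri a b' c') = tri e1 e2 e2" "g (tri a' b' c') = tri e2 e2 e2"
proof -
  obtain A B C where *: "invertible A" "A *v a = e1" "A *v a' = e2"
    "invertible B" "B *v b = e1" "B *v b' = e2" "invertible C" "C *v c = e1" "C *v c' = e2"
    using assms by (metis wedge_basis_to_axes)
  show thesis by (rule tri_map[OF *(1,4,7)], erule that) (simp_all add: *)
qed

lemma tri_swap:
  obtains g where "segre_linear g" "\<And>a b c. g (tri a b c) = tri b a c"
proof
  let ?\<tau> = "\<lambda>i::3. if i = 1 then 2 else if i = 2 then 1 else i"
  have bij: "bij ?\<tau>" by (rule involuntory_imp_bij) auto
  then show "segre_linear (permute_factors ?\<tau>)" by (rule segre_linear_permute_factors)
  show "permute_factors ?\<tau> (tri a b c) = tri b a c" for a b c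
    by (simp add: vec_eq_iff permute_factors_def tri_nth)
qed

lemma tri_swap_outer:
  obtains g where "segre_linear g" "\<And>a b c. g (tri a b c) = tri c b a"
proof
  let ?\<tau> = "\<lambda>i::3. if i = 1 then 3 else if i = 3 then 1 else i"
  have bij: "bij ?\<tau>" by (rule involuntory_imp_bij) auto
  then show "segre_linear (permute_factors ?\<tau>)" by (rule segre_linear_permute_factors)
  show "permute_factors ?\<tau> (tri a b c) = tri c b a" for a b c
    by (simp add: vec_eq_iff permute_factors_def tri_nth)
qed

lemma equiv_segre_rep:
  assumes "a \<noteq> 0" "b \<noteq> 0" "c \<noteq> 0"
  shows "segre_equiv (tri a b c) segre_rep"
proof -
  obtain a' b' c' where bases: "wedge a a' \<noteq> 0" "wedge b b' \<noteq> 0" "wedge c c' \<noteq> 0"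
    using assms by (metis wedge_extend)
  show ?thesis
    by (rule tri_basis_map[OF bases]) (auto simp: segre_equiv_def segre_rep_def)
qed

lemma equiv_secant_rep:
  assumes "wedge a a' \<noteq> 0" "wedge b b' \<noteq> 0" "wedge c c' \<noteq> 0"
  shows "segre_equiv (tri a b c + tri a' b' c') secant_rep"
  by (rule tri_basis_map[OF assms])
    (auto intro!: exI simp: segre_equiv_def secant_rep_def segre_linear_add)

lemma equiv_tangent_rep:
  assumes "wedge a a' \<noteq> 0" "wedge b b' \<noteq> 0" "wedge c c' \<noteq> 0"
  shows "segre_equiv (tri a' b c + tri a b' c + tri a b c') tangent_rep"
  by (rule tri_basis_map[OF assms])
    (auto intro!: exI simp: segre_equiv_def tangent_rep_def segre_linear_add)

lemma equiv_biseparable_rep: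
  assumes "a \<noteq> 0" "wedge b b' \<noteq> 0" "wedge c c' \<noteq> 0"
  shows "segre_equiv (tri a b c + tri a b' c') biseparable_rep"
    and "segre_equiv (tri b a c + tri b' a c') biseparable_rep"
    and "segre_equiv (tri c b a + tri c' b' a) biseparable_rep"
proof -
  obtain a' where a': "wedge a a' \<noteq> 0" using assms by (metis wedge_extend)
  show 1: "segre_equiv (tri a b c + tri a b' c') biseparable_rep"
    by (rule tri_basis_map[OF a' assms(2,3)])
      (auto intro!: exI simp: segre_equiv_def biseparable_rep_def segre_linear_add)
  have "segre_equiv (tri b a c + tri b' a c') (tri a b c + tri a b' c')"
    by (rule tri_swap) (auto intro!: exI simp: segre_equiv_def segre_linear_add)
  then show "segre_equiv (tri b a c + tri b' a c') biseparable_rep"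
    using 1 by (rule segre_equiv_trans)
  have "segre_equiv (tri c b a + tri c' b' a) (tri a b c + tri a b' c')"
    by (rule tri_swap_outer) (auto intro!: exI simp: segre_equiv_def segre_linear_add)
  then show "segre_equiv (tri c b a + tri c' b' a) biseparable_rep"
    using 1 by (rule segre_equiv_trans)
qed

lemma contraction_as_factor_map:
  fixes A :: "'a::field ^ 2 ^ 2"
  assumes "\<And>x. (\<Sum>k\<in>UNIV. A $ 2 $ k * x $ k) = w x" "f i = 2"
  shows "factor_map i A v $ f = contraction i w v $ f"
  using assms(1)[of "\<chi> k. v $ f(i := k)"] assms(2)
  by (simp add: factor_map_def contraction_def)

text \<open>
  Let the contractions in places \<open>i\<close> and \<open>j\<close> with \<open>w\<close> and \<open>w'\<close> kill \<open>v\<close>. After a change of bases, the two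
  functionals read off the second coordinate, so all entries with second coordinate in both places
  vanish. Moving \<open>i\<close> and \<open>j\<close> to the first two places leaves three vectors in the last factor.
\<close>

lemma singular_normal_form:
  fixes v :: "'a::field V222"
  assumes "\<not> nonsingular_tensor UNIV v"
  obtains c1 c2 c3 where "segre_equiv v (tri e1 e1 c1 + tri e1 e2 c2 + tri e2 e1 c3)"
proof -
  obtain i j w w' where "i \<noteq> j"
    and w: "Vector_Spaces.linear (*s) (*) w" "w \<noteq> (\<lambda>_. 0)"
    and w': "Vector_Spaces.linear (*s) (*) w'" "w' \<noteq> (\<lambda>_. 0)"
    and contr: "contraction j w' (contraction i w v) = 0"
    using assms unfolding singular_iff by blast
  obtain A :: "'a ^ 2 ^ 2" where A: "invertible A" "\<And>x. (\<Sum>k\<in>UNIV. A $ 2 $ k * x $ k) = w x"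
    using functional_as_row[OF w] by metis
  obtain B :: "'a ^ 2 ^ 2" where B: "invertible B" "\<And>x. (\<Sum>k\<in>UNIV. B $ 2 $ k * x $ k) = w' x"
    using functional_as_row[OF w'] by metis
  define v1 where "v1 = factor_map j B (factor_map i A v)"
  have v1: "v1 $ f = 0" if "f i = 2" "f j = 2" for f
  proof -
    have "factor_map i A v $ f(j := k) = contraction i w v $ f(j := k)" for k
      using that \<open>i \<noteq> j\<close> by (intro contraction_as_factor_map A(2)) simp
    moreover have "v1 $ f = contraction j w' (factor_map i A v) $ f"
      unfolding v1_def by (rule contraction_as_factor_map) (rule B(2), rule that(2))
    ultimately have "v1 $ f = contraction j w' (contraction i w v) $ f"
      by (simp add: contraction_def[of j])
    then show ?thesis by (simp add: contr)
  qed
  define \<tau> where "\<tau> k = (if k = i then 1 else if k = j then 2 else 3 :: 3)" for k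
  have "inj \<tau>"
  proof (rule injI)
    fix k l assume "\<tau> k = \<tau> l"
    moreover obtain m where "\<And>k. k = i \<or> k = j \<or> k = m"
      using third_index[OF \<open>i \<noteq> j\<close>] by (metis UNIV_I insertE singletonD)
    from this[of k] this[of l] calculation show "k = l"
      unfolding \<tau>_def by (auto split: if_splits)
  qed
  then have "bij \<tau>" by (simp add: bij_def finite_UNIV_inj_surj)
  define v2 where "v2 = permute_factors \<tau> v1"
  have v2: "v2 $ f = 0" if "f 1 = 2" "f 2 = 2" for f
    unfolding v2_def permute_factors_def using v1[of "f \<circ> \<tau>"] that \<open>i \<noteq> j\<close> by (simp add: \<tau>_def)
  have "segre_linear (permute_factors \<tau> \<circ> (factor_map j B \<circ> factor_map i A))"
    by (intro segre_linear_comp segre_linear_factor_map segre_linear_permute_factors A B \<open>bij \<tau>\<close>)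
  then have "segre_equiv v v2"
    unfolding segre_equiv_def v2_def v1_def by (intro exI conjI) (assumption, simp)
  moreover have "v2 = tri e1 e1 (\<chi> k. v2 $ ((\<lambda>_. k)(1 := 1, 2 := 1)))
      + tri e1 e2 (\<chi> k. v2 $ ((\<lambda>_. k)(1 := 1, 2 := 2)))
      + tri e2 e1 (\<chi> k. v2 $ ((\<lambda>_. k)(1 := 2, 2 := 1)))" (is "_ = ?r")
  proof -
    have "v2 $ f = ?r $ f" for f
    proof -
      have f: "v2 $ f = v2 $ ((\<lambda>_. f 3)(1 := f 1, 2 := f 2))"
        by (rule arg_cong[of _ _ "($) v2"]) (simp add: fun_eq_iff forall_3)
      consider "f 1 = 1" "f 2 = 1" | "f 1 = 1" "f 2 = 2" | "f 1 = 2" "f 2 = 1" | "f 1 = 2" "f 2 = 2"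
        using exhaust_2 by metis
      then show ?thesis
      proof cases
        case 4 then show ?thesis by (simp add: tri_nth v2 axis_def)
      qed (simp_all add: f tri_nth axis_def)
    qed
    then show ?thesis unfolding vec_eq_iff by (intro allI)
  qed
  ultimately show thesis using that by metis
qed

text \<open>
  The outcome depends on the linear relations among \<open>c1\<close>, \<open>c2\<close> and \<open>c3\<close>.
  If \<open>c2\<close> and \<open>c3\<close> are independent, \<open>c1\<close> can be absorbed into the other two terms, which gives a sum
  of two pure tensors that are independent in every place. If they are parallel and nonzero, and
  \<open>c1\<close> is not parallel to them, the three terms form \<open>tangent_rep\<close>. In all remaining cases the sum
  collapses to a pure tensor or to two pure tensors that share a factor.
\<close>

lemma tri_normal_form_equiv_rep:
  fixes x :: "'a::field V222"
  assumes "x = tri e1 e1 c1 + tri e1 e2 c2 + tri e2 e1 c3" "x \<noteq> 0"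
  shows "\<exists>r\<in>reps. segre_equiv x r"
proof (cases "wedge c2 c3 = 0")
  case False
  then obtain s t where "c1 = s *s c2 + t *s c3" by (rule wedge_span)
  then have "x = tri e1 (s *s e1 + e2) c2 + tri (t *s e1 + e2) e1 c3"
    unfolding assms(1) by (simp add: vec_eq_iff tri_nth algebra_simps)
  moreover have "wedge e1 (t *s e1 + e2) \<noteq> 0" "wedge (s *s e1 + e2) e1 \<noteq> 0"
    by (simp_all add: wedge_def axis_def)
  ultimately have "segre_equiv x secant_rep" using False equiv_secant_rep by blast
  then show ?thesis by (auto simp: reps_def)
next
  case par: True
  have tri_0 [simp]: "tri a b 0 = 0" "tri 0 b c = 0" for a b c :: "'a ^ 2" by (simp_all add: tri_eq_0_iff)
  have e: "e1 \<noteq> (0 :: 'a ^ 2)" "e2 \<noteq> (0 :: 'a ^ 2)" by (simp_all add: axis_eq_0_iff)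
  have e_wedge: "wedge e1 e2 \<noteq> (0 :: 'a)" "wedge e1 (t *s e2) \<noteq> 0 \<longleftrightarrow> t \<noteq> (0 :: 'a)" for t
    by (simp_all add: wedge_def axis_def)
  have comb: "s *s e1 + t *s e2 \<noteq> 0" if "t \<noteq> 0" for s t :: 'a
    using that by (simp add: vec_eq_iff forall_2 axis_def)
  show ?thesis
  proof (cases "c2 = 0")
    case True
    then have x: "x = tri e1 e1 c1 + tri e2 e1 c3" using assms(1) by simp
    show ?thesis
    proof (cases "wedge c1 c3 = 0")
      case False
      then have "segre_equiv x biseparable_rep"
        unfolding x using equiv_biseparable_rep(2) e e_wedge by blast
      then show ?thesis by (auto simp: reps_def)
    next
      case par': True
      show ?thesis
      proof (cases "c3 = 0")
        case True
        then have "x = tri e1 e1 c1" using x by simp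
        then have "segre_equiv x segre_rep" using assms(2) equiv_segre_rep e by (metis tri_eq_0_iff)
        then show ?thesis by (auto simp: reps_def)
      next
        case False
        then obtain s where "c1 = s *s c3"
          using par' wedge_eq_0_imp_multiple[of c3 c1] wedge_commute[of c3 c1] by auto
        then have "x = tri (s *s e1 + 1 *s e2) e1 c3"
          unfolding x by (simp add: vec_eq_iff tri_nth algebra_simps)
        then have "segre_equiv x segre_rep" using False e comb[of 1 s] by (simp add: equiv_segre_rep)
        then show ?thesis by (auto simp: reps_def)
      qed
    qed
  next
    case False
    then obtain t where c3: "c3 = t *s c2" using par by (metis wedge_eq_0_imp_multiple)
    \<comment> \<open>The terms are arranged as the neighbours of \<open>tri e1 e1 c2\<close> in the order of \<open>tangent_rep\<close>.\<close>
    then have x: "x = tri (t *s e2) e1 c2 + tri e1 e2 c2 + tri e1 e1 c1"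
      unfolding assms(1) by (simp add: vec_eq_iff tri_nth algebra_simps)
    show ?thesis
    proof (cases "wedge c2 c1 = 0")
      case indep: False
      show ?thesis
      proof (cases "t = 0")
        case True
        then have "x = tri e1 e2 c2 + tri e1 e1 c1" using x by simp
        moreover have "wedge e2 e1 \<noteq> (0 :: 'a)" by (simp add: wedge_def axis_def)
        ultimately have "segre_equiv x biseparable_rep"
          using equiv_biseparable_rep(1) e indep by blast
        then show ?thesis by (auto simp: reps_def)
      next
        case False
        then have "segre_equiv x tangent_rep"
          unfolding x using equiv_tangent_rep indep e_wedge by blast
        then show ?thesis by (auto simp: reps_def)
      qed
    next
      case True
      then obtain s where "c1 = s *s c2" using \<open>c2 \<noteq> 0\<close> by (metis wedge_eq_0_imp_multiple)
      then have x': "x = tri e1 (s *s e1 + 1 *s e2) c2 + tri (t *s e2) e1 c2"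
        unfolding x by (simp add: vec_eq_iff tri_nth algebra_simps)
      show ?thesis
      proof (cases "t = 0")
        case True
        then have "segre_equiv x segre_rep"
          using x' e comb[of 1 s] \<open>c2 \<noteq> 0\<close> by (simp add: equiv_segre_rep)
        then show ?thesis by (auto simp: reps_def)
      next
        case False
        moreover have "wedge (s *s e1 + 1 *s e2) e1 \<noteq> 0" by (simp add: wedge_def axis_def)
        ultimately have "segre_equiv x biseparable_rep"
          unfolding x' using equiv_biseparable_rep(3) e_wedge \<open>c2 \<noteq> 0\<close> by blast
        then show ?thesis by (auto simp: reps_def)
      qed
    qed
  qed
qed

lemma singular_equiv_rep:
  assumes "\<not> nonsingular_tensor UNIV v" "v \<noteq> 0"
  shows "\<exists>r\<in>reps. segre_equiv v r"
proof -
  obtain c1 c2 c3 where *: "segre_equiv v (tri e1 e1 c1 + tri e1 e2 c2 + tri e2 e1 c3)"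
    using assms(1) by (rule singular_normal_form)
  then have "tri e1 e1 c1 + tri e1 e2 c2 + tri e2 e1 c3 \<noteq> 0"
    using segre_linear_nonzero assms(2) unfolding segre_equiv_def by metis
  from tri_normal_form_equiv_rep[OF refl this] show ?thesis
    using segre_equiv_trans[OF *] by blast
qed

lemma rep_secant_or_tangent:
  fixes r :: "'a::field V222"
  assumes "r \<in> reps" shows "r \<in> secants \<union> tangents"
proof -
  have "segre_rep \<in> (secants :: 'a V222 set)"
    using decomposable_subset_linked_secants linked_secants_subset_secants tri_decomposable
    unfolding segre_rep_def by blast
  then show ?thesis
    using assms tangent_rep_tangent
    by (auto simp: reps_def biseparable_rep_def secant_rep_def intro!: secantsI tri_decomposable)
qed

text \<open>
  This is what makes singularity an invariant of the stabiliser: although it is defined through the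
  tensor factors, it can be read off from the set of decomposable tensors. By the normal forms
  it suffices to check the inclusion from left to right for the representatives.
\<close>

lemma singular_iff_secant_or_tangent:
  "\<not> nonsingular_tensor UNIV v \<longleftrightarrow> v \<in> secants \<union> tangents" for v :: "'a::field V222"
proof
  assume sing: "\<not> nonsingular_tensor UNIV v"
  show "v \<in> secants \<union> tangents"
  proof (cases "v = 0")
    case True
    then show ?thesis unfolding secants_def using zero_decomposable by force
  next
    case False
    then obtain r g where "r \<in> reps" and g: "segre_linear g" "g r = v"
      using singular_equiv_rep[OF sing] segre_equiv_sym unfolding segre_equiv_def by metis
    then have "r \<in> secants \<union> tangents" by (intro rep_secant_or_tangent)
    then show ?thesis
      using g segre_linear_secants segre_linear_tangents by blast
  qed
qed (use secants_singular tangents_singular in blast)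

lemma segre_linear_singular:
  fixes v :: "'a::field V222"
  assumes "segre_linear g" "\<not> nonsingular_tensor UNIV v"
  shows "\<not> nonsingular_tensor UNIV (g v)"
  using assms segre_linear_secants segre_linear_tangents
  unfolding singular_iff_secant_or_tangent by blast

lemma reps_singular:
  fixes r :: "'a::field V222"
  assumes "r \<in> reps" shows "r \<noteq> 0" "\<not> nonsingular_tensor UNIV r"
proof -
  show "\<not> nonsingular_tensor UNIV r"
    using rep_secant_or_tangent[OF assms] by (simp add: singular_iff_secant_or_tangent)
  have "segre_rep \<noteq> (0 :: 'a V222)" by (simp add: segre_rep_def tri_eq_0_iff axis_eq_0_iff)
  moreover have "stratum (0 :: 'a V222) = 1" by (simp add: stratum_def zero_decomposable)
  ultimately show "r \<noteq> 0" using assms stratum_reps[where ?'a = 'a] by (auto simp: reps_def)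
qed

section \<open>The stabiliser of the Segre variety acting on singular points\<close>

lemma span_singleton_eq_scale:
  fixes v w :: "'a::field ^ 'n::finite"
  assumes "vec.span {v} = vec.span {w}" "v \<noteq> 0"
  obtains c where "c \<noteq> 0" "v = c *s w"
proof -
  have "v \<in> vec.span {w}" using assms(1) vec.span_base by blast
  then obtain c where "v = c *s w" by (auto simp: vec.span_singleton)
  with assms(2) show thesis by (intro that[of c]) auto
qed

lemma linear_image_span_singleton:
  "Vector_Spaces.linear (*s) (*s) g \<Longrightarrow> g ` vec.span {v} = vec.span {g v}"
  for g :: "'a::field ^ 'n::finite \<Rightarrow> 'a ^ 'm::finite"
  using vec.linear_span_image[of g "{v}"] by simp

definition projective_map ::
    "('a::field ^ 'n::finite \<Rightarrow> 'a ^ 'n) \<Rightarrow> ('a ^ 'n) set \<Rightarrow> ('a ^ 'n) set" where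
  "projective_map g = restrict (image g) PG"

lemma projective_map_point:
  assumes "Vector_Spaces.linear (*s) (*s) g" "v \<noteq> 0"
  shows "projective_map g (vec.span {v}) = vec.span {g v}"
proof -
  have "vec.span {v} \<in> PG" using assms(2) by (auto simp: PG_def)
  then show ?thesis by (simp add: projective_map_def linear_image_span_singleton[OF assms(1)])
qed

lemma segre_222_eq: "segre_222 = {vec.span {p} | p. p \<in> decomposable \<and> p \<noteq> 0}"
  unfolding segre_222_def decomposable_def by (auto simp: pure_tensor_eq_0_iff)

lemma span_mem_segre_222:
  assumes "vec.span {v} \<in> segre_222" "v \<noteq> 0" shows "v \<in> decomposable"
proof -
  obtain p where p: "vec.span {v} = vec.span {p}" "p \<in> decomposable"
    using assms(1) by (auto simp: segre_222_eq)
  obtain c where "v = c *s p" using p(1) assms(2) by (rule span_singleton_eq_scale)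
  with p(2) show ?thesis by (simp add: scale_decomposable)
qed

text \<open>
  The set of decomposable tensors is closed under scalars, so it is the cone over the Segre variety
  and determines it, and is determined by it.
\<close>

lemma projective_map_image_segre_iff:
  assumes g: "Vector_Spaces.linear (*s) (*s) g" "bij g"
  shows "projective_map g ` segre_222 = segre_222 \<longleftrightarrow> g ` decomposable = decomposable"
proof -
  have nz: "g v \<noteq> 0 \<longleftrightarrow> v \<noteq> 0" for v
    using g by (metis vec.linear_0 bij_is_inj injD)
  have im: "projective_map g ` segre_222 = {vec.span {g p} | p. p \<in> decomposable \<and> p \<noteq> 0}"
    unfolding segre_222_eq by (force simp: projective_map_point[OF g(1)])
  show ?thesis
  proof
    assume eq: "projective_map g ` segre_222 = segre_222"
    show "g ` decomposable = decomposable"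
    proof (intro equalityI subsetI)
      fix q assume "q \<in> g ` decomposable"
      then obtain p where p: "p \<in> decomposable" "q = g p" by auto
      show "q \<in> decomposable"
      proof (cases "p = 0")
        case True
        then show ?thesis using p(2) nz[of p] zero_decomposable by simp
      next
        case False
        then have "vec.span {q} \<in> segre_222" using p im eq by blast
        then show ?thesis using span_mem_segre_222 nz[of p] p(2) False by blast
      qed
    next
      fix q :: "'a V222" assume q: "q \<in> decomposable"
      show "q \<in> g ` decomposable"
      proof (cases "q = 0")
        case True
        then show ?thesis using vec.linear_0[OF g(1)] zero_decomposable by (metis imageI)
      next
        case False
        then have "vec.span {q} \<in> segre_222" using q by (auto simp: segre_222_eq)
        then have "vec.span {q} \<in> projective_map g ` segre_222" by (simp add: eq)
        then obtain p where p: "p \<in> decomposable" "vec.span {q} = vec.span {g p}"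
          unfolding im by blast
        obtain c where "q = c *s g p" using p(2) False by (rule span_singleton_eq_scale)
        then have "q = g (c *s p)" using vec.linear_scale[OF g(1)] by simp
        then show ?thesis using p(1) scale_decomposable by blast
      qed
    qed
  next
    assume eq: "g ` decomposable = decomposable"
    have "projective_map g ` segre_222 = {vec.span {q} | q. q \<in> g ` decomposable \<and> q \<noteq> 0}"
      unfolding im using nz by blast
    then show "projective_map g ` segre_222 = segre_222" by (simp add: eq segre_222_eq)
  qed
qed

lemma carrier_setwise_stabiliser_segre:
  "carrier (setwise_stabiliser segre_222) = {projective_map g | g. segre_linear g}"
  using projective_map_image_segre_iff
  by (auto simp: setwise_stabiliser_def PGL_def segre_linear_def projective_map_def[symmetric])

lemma projective_map_Bij:
  fixes g :: "('a::field, 'i::finite, 'd::finite) tensor \<Rightarrow> ('a, 'i, 'd) tensor"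
  assumes "segre_linear g" shows "projective_map g \<in> Bij PG"
proof -
  have g: "Vector_Spaces.linear (*s) (*s) g" "bij g" using assms by (auto simp: segre_linear_def)
  have h: "Vector_Spaces.linear (*s) (*s) (inv_into UNIV g)"
    using segre_linear_inv[OF assms] by (simp add: segre_linear_def)
  have "bij_betw (image g) PG PG"
  proof (rule bij_betw_byWitness[where f' = "image (inv_into UNIV g)"])
    show "\<forall>P\<in>PG. inv_into UNIV g ` g ` P = P" "\<forall>P\<in>PG. g ` inv_into UNIV g ` P = P"
      using g(2) by (simp_all add: bij_is_inj bij_is_surj image_f_inv_f)
    have sub: "image k ` PG \<subseteq> PG" if k: "Vector_Spaces.linear (*s) (*s) k" "inj k"
      for k :: "('a, 'i, 'd) tensor \<Rightarrow> ('a, 'i, 'd) tensor"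
    proof
      fix Q assume "Q \<in> image k ` PG"
      then obtain v where v: "Q = k ` vec.span {v}" "v \<noteq> 0" by (auto simp: PG_def)
      have "k v \<noteq> 0" using k v(2) by (metis vec.linear_0 injD)
      then show "Q \<in> PG" using linear_image_span_singleton[OF k(1)] v(1) by (auto simp: PG_def)
    qed
    show "image g ` PG \<subseteq> PG" using sub g by (simp add: bij_is_inj)
    show "image (inv_into UNIV g) ` PG \<subseteq> PG"
      using sub[OF h] bij_imp_bij_inv[OF g(2)] by (simp add: bij_is_inj)
  qed
  then show ?thesis by (simp add: Bij_def projective_map_def)
qed

lemma projective_map_comp:
  assumes "segre_linear h"
  shows "projective_map (g \<circ> h) = compose PG (projective_map g) (projective_map h)"
proof
  fix P show "projective_map (g \<circ> h) P = compose PG (projective_map g) (projective_map h) P"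
  proof (cases "P \<in> PG")
    case True
    then have "projective_map h P \<in> PG"
      using Bij_imp_funcset[OF projective_map_Bij[OF assms]] by blast
    with True show ?thesis by (simp add: compose_def projective_map_def image_comp)
  qed (simp add: compose_def projective_map_def)
qed

lemma setwise_stabiliser_segre_subgroup:
  "subgroup {projective_map g | g. segre_linear g} (BijGroup PG)"
proof -
  interpret group "BijGroup PG" by (rule group_BijGroup)
  have mult: "projective_map g \<otimes>\<^bsub>BijGroup PG\<^esub> projective_map h = projective_map (g \<circ> h)"
    if "segre_linear g" "segre_linear h" for g h
    using that by (simp add: BijGroup_def projective_map_Bij projective_map_comp)
  have one: "projective_map id = \<one>\<^bsub>BijGroup PG\<^esub>"
    by (simp add: BijGroup_def projective_map_def restrict_def fun_eq_iff)
  have car: "projective_map g \<in> carrier (BijGroup PG)" if "segre_linear g" for g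
    using that by (simp add: BijGroup_def projective_map_Bij)
  show ?thesis
  proof (rule subgroupI)
    fix \<pi> assume "\<pi> \<in> {projective_map g | g. segre_linear g}"
    then obtain g where g: "segre_linear g" "\<pi> = projective_map g" by blast
    have "inv_into UNIV g \<circ> g = id" using g(1) by (simp add: segre_linear_def bij_is_inj)
    then have "projective_map (inv_into UNIV g) \<otimes>\<^bsub>BijGroup PG\<^esub> \<pi> = \<one>\<^bsub>BijGroup PG\<^esub>"
      by (simp add: g mult segre_linear_inv one)
    then have "inv\<^bsub>BijGroup PG\<^esub> \<pi> = projective_map (inv_into UNIV g)"
      using car g segre_linear_inv by (intro inv_equality) auto
    then show "inv\<^bsub>BijGroup PG\<^esub> \<pi> \<in> {projective_map g | g. segre_linear g}"
      using segre_linear_inv[OF g(1)] by blast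
  qed (use car mult segre_linear_id segre_linear_comp in \<open>auto, blast\<close>)
qed

lemma singular_points_image:
  assumes "segre_linear g"
  shows "projective_map g ` singular_points = singular_points"
proof -
  have sub: "projective_map k ` singular_points \<subseteq> singular_points" if k: "segre_linear k"
    for k :: "'a::field V222 \<Rightarrow> 'a V222"
  proof
    fix P assume "P \<in> projective_map k ` singular_points"
    then obtain v where v: "P = projective_map k (vec.span {v})" "v \<noteq> 0" "\<not> nonsingular_tensor UNIV v"
      by (auto simp: singular_points_def)
    then have "P = vec.span {k v}" using k by (simp add: projective_map_point segre_linear_def)
    then show "P \<in> singular_points"
      using segre_linear_nonzero[OF k v(2)] segre_linear_singular[OF k v(3)]
      unfolding singular_points_def by blast
  qed
  show ?thesis
  proof (intro equalityI sub[OF assms] subsetI)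
    fix P :: "'a V222 set" assume "P \<in> singular_points"
    then obtain v where v: "P = vec.span {v}" "v \<noteq> 0" "\<not> nonsingular_tensor UNIV v"
      by (auto simp: singular_points_def)
    let ?w = "inv_into UNIV g v"
    have w: "?w \<noteq> 0" "\<not> nonsingular_tensor UNIV ?w"
      using v segre_linear_inv[OF assms] segre_linear_nonzero segre_linear_singular by blast+
    have "g ?w = v" using assms by (simp add: segre_linear_def bij_is_surj surj_f_inv_f)
    then have "P = projective_map g (vec.span {?w})"
      using assms w(1) v(1) by (simp add: projective_map_point segre_linear_def)
    then show "P \<in> projective_map g ` singular_points"
      using w unfolding singular_points_def by blast
  qed
qed

lemma singular_points_subset_PG: "singular_points \<subseteq> PG"
  by (auto simp: singular_points_def PG_def)

lemma group_action_restrict: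
  assumes H: "subgroup H (BijGroup S)" and "E \<subseteq> S" and E: "\<And>\<pi>. \<pi> \<in> H \<Longrightarrow> \<pi> ` E = E"
  shows "group_action (BijGroup S \<lparr>carrier := H\<rparr>) E (\<lambda>\<pi>. restrict \<pi> E)"
proof -
  have HS: "\<pi> \<in> Bij S" if "\<pi> \<in> H" for \<pi>
    using subgroup.subset[OF H] that by (auto simp: BijGroup_def)
  have Bij: "restrict \<pi> E \<in> Bij E" if "\<pi> \<in> H" for \<pi>
  proof -
    have "inj_on \<pi> E"
      using HS[OF that] \<open>E \<subseteq> S\<close> inj_on_subset by (auto simp: Bij_def bij_betw_def)
    then show ?thesis using E[OF that] by (simp add: Bij_def bij_betw_def)
  qed
  have "restrict (compose S \<pi> \<rho>) E = compose E (restrict \<pi> E) (restrict \<rho> E)"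
    if "\<rho> \<in> H" for \<pi> \<rho>
    using E[OF that] \<open>E \<subseteq> S\<close> by (auto simp: compose_def fun_eq_iff)
  then have "(\<lambda>\<pi>. restrict \<pi> E) \<in> hom (BijGroup S \<lparr>carrier := H\<rparr>) (BijGroup E)"
    using Bij HS by (auto simp: hom_def BijGroup_def)
  moreover have "group (BijGroup S \<lparr>carrier := H\<rparr>)"
    using subgroup.subgroup_is_group[OF H group_BijGroup] .
  ultimately show ?thesis
    by (intro group_action.intro group_hom.intro group_hom_axioms.intro group_BijGroup)
qed

lemma setwise_stabiliser_segre_eq:
  "setwise_stabiliser segre_222 = BijGroup PG \<lparr>carrier := {projective_map g | g. segre_linear g}\<rparr>"
proof -
  have "setwise_stabiliser segre_222
      = BijGroup PG \<lparr>carrier := carrier (setwise_stabiliser segre_222)\<rparr>"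
    by (simp add: setwise_stabiliser_def PGL_def)
  then show ?thesis by (simp only: carrier_setwise_stabiliser_segre)
qed

theorem theorem3p4:
  fixes G\<^sub>X :: "('a::field V222 set \<Rightarrow> 'a V222 set) monoid"
  assumes "G\<^sub>X = setwise_stabiliser segre_222"
  shows "group_action G\<^sub>X singular_points (\<lambda>\<pi>. restrict \<pi> singular_points) \<and>
         card (orbits G\<^sub>X singular_points (\<lambda>\<pi>. restrict \<pi> singular_points)) = 4"
proof
  let ?\<phi> = "\<lambda>\<pi>. restrict \<pi> (singular_points :: 'a V222 set set)"
  show act: "group_action G\<^sub>X singular_points ?\<phi>"
    unfolding assms setwise_stabiliser_segre_eq
  proof (rule group_action_restrict[OF setwise_stabiliser_segre_subgroup singular_points_subset_PG])
    fix \<pi> :: "'a V222 set \<Rightarrow> 'a V222 set"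
    assume "\<pi> \<in> {projective_map g | g. segre_linear g}"
    then show "\<pi> ` singular_points = singular_points" using singular_points_image by blast
  qed
  define orb where "orb v = orbit G\<^sub>X ?\<phi> (vec.span {v})" for v :: "'a V222"
  have orb: "orb v = {vec.span {w} | w. segre_equiv v w}"
    if "v \<noteq> 0" "\<not> nonsingular_tensor UNIV v" for v
  proof -
    have "vec.span {v} \<in> singular_points" using that by (auto simp: singular_points_def)
    then have "?\<phi> (projective_map g) (vec.span {v}) = vec.span {g v}" if "segre_linear g" for g
      using that \<open>v \<noteq> 0\<close> by (simp add: projective_map_point segre_linear_def)
    then have "{?\<phi> (projective_map g) (vec.span {v}) | g. segre_linear g}
        = {vec.span {g v} | g. segre_linear g}" by (metis (lifting))
    moreover have "orb v = {?\<phi> (projective_map g) (vec.span {v}) | g. segre_linear g}"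
      unfolding orb_def orbit_def assms carrier_setwise_stabiliser_segre by blast
    ultimately show ?thesis by (auto simp: segre_equiv_def)
  qed
  have mem: "vec.span {v} \<in> singular_points" if "v \<noteq> 0" "\<not> nonsingular_tensor UNIV v"
    for v :: "'a V222" using that by (auto simp: singular_points_def)
  have orbits: "orbits G\<^sub>X singular_points ?\<phi> = orb ` reps"
  proof (intro equalityI subsetI)
    fix B assume "B \<in> orbits G\<^sub>X singular_points ?\<phi>"
    then obtain v where v: "B = orb v" "v \<noteq> 0" "\<not> nonsingular_tensor UNIV v"
      by (auto simp: orbits_def singular_points_def orb_def)
    obtain r where r: "r \<in> reps" "segre_equiv v r"
      using singular_equiv_rep[OF v(3,2)] by blast
    have "segre_equiv v w \<longleftrightarrow> segre_equiv r w" for w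
      using r(2) segre_equiv_sym segre_equiv_trans by blast
    then have "B = orb r" using v orb reps_singular[OF r(1)] by simp
    with r(1) show "B \<in> orb ` reps" by blast
  next
    fix B assume "B \<in> orb ` reps"
    then show "B \<in> orbits G\<^sub>X singular_points ?\<phi>"
      using reps_singular mem unfolding orbits_def orb_def by blast
  qed
  have "inj_on orb reps"
  proof (rule inj_onI)
    fix r r' :: "'a V222" assume r: "r \<in> reps" "r' \<in> reps" and eq: "orb r = orb r'"
    have "segre_equiv r' r'" unfolding segre_equiv_def using segre_linear_id by (metis id_apply)
    then have "vec.span {r'} \<in> orb r" using eq orb[of r'] reps_singular[OF r(2)] by blast
    then obtain g where g: "segre_linear g" "vec.span {r'} = vec.span {g r}"
      using orb[of r] reps_singular[OF r(1)] by (auto simp: segre_equiv_def)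
    \<comment> \<open>Equality of points gives equality of tensors up to a scalar, and scaling preserves the stratum.\<close>
    obtain c where "c \<noteq> 0" "r' = c *s g r"
      using g(2) reps_singular(1)[OF r(2)] by (rule span_singleton_eq_scale)
    then have "stratum r = stratum r'"
      by (simp add: segre_linear_stratum[OF segre_linear_scale] segre_linear_stratum[OF g(1)])
    then show "r = r'" using r by (rule inj_onD[OF inj_on_stratum_reps])
  qed
  then show "card (orbits G\<^sub>X singular_points ?\<phi>) = 4"
    unfolding orbits by (simp add: card_image card_reps)
qed

end
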